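(* Let $d\ge 1$ and let $\mathbb{P}$ be the probability distribution on $\mathcal{P}([0,1]^d)$ described in the context. Then for $\mathbb{P}$-a.e. $\mu$, the upper Assouad dimension satisfies $\dim_A\mu=\infty$.
   Context: $\mathcal{P}([0,1]^d)$ is the space of Borel probability measures on $[0,1]^d$, with the weak$^*$ topology. Dyadic cubes. Put $n=2^d$, $\Lambda=\{1,\dots,n\}$, $\Omega=\bigcup_{k\ge 0}\Lambda^k$ (finite words, including the empty word $\emptyset$; $|\omega|$ is the length of $\omega$). Words index the dyadic subcubes $Q_\omega$ of $[0,1]^d$: $Q_\emptyset=[0,1]^d$, and $Q_{\omega 1},\dots,Q_{\omega n}$ are the $2^d$ dyadic cubes of side length $2^{-|\omega|-1}$ partitioning $Q_\omega$ (products of half-open intervals $[a,b)$, closed on the right when $b=1$). Distribution $\mathbb{P}$. Let $X^\omega=(X^\omega_1,\dots,X^\omega_n)$, $\omega\in\Omega$, be independent random vectors, each uniformly distributed on the simplex $\{(x_1,\dots,x_n): x_i\ge 0,\ \sum_i x_i=1\}$. Almost surely this determines a unique random measure $\mu\in\mathcal{P}([0,1]^d)$ with $\mu(Q_{\omega_1\cdots\omega_k})=\prod_{j=1}^k X^{\omega_1\cdots\omega_{j-1}}_{\omega_j}$ for all words. $\mathbb{P}$ is the law of $\mu$. Upper Assouad dimension. For $\mu\in\mathcal{P}([0,1]^d)$, $\dim_A\mu$ is the infimum (with $\inf\emptyset=\infty$) of all $s$ for which there is $C>0$ such that for all $0<r<R<1$, $\sup_{x\in\operatorname{supp}\mu}\frac{\mu(B(x,R))}{\mu(B(x,r))}\le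 C\left(\frac Rr\right)^s$. Balls are Euclidean (any equivalent metric gives the same value). *)

theory Defs
  imports "HOL-Probability.Probability"
begin

section \<open>Probability measures on the unit cube\<close>

abbreviation unit_cube :: "(real ^ 'd) set" where
  "unit_cube \<equiv> cbox 0 1"

abbreviation cube_borel :: "(real ^ 'd) measure" where
  "cube_borel \<equiv> restrict_space borel unit_cube"

definition prob_measures :: "(real ^ 'd) measure set" where
  "prob_measures = {\<nu>. prob_space \<nu> \<and> sets \<nu> = sets cube_borel}"

text \<open>
  The coarsest topology for which \<open>\<nu> \<mapsto> \<integral> f d\<nu>\<close> is continuous for each continuous
  \<open>f\<close> on the cube. Taking \<open>U = UNIV\<close> shows that its underlying set is \<open>prob_measures\<close>.
\<close>

definition weak_star_topology :: "(real ^ 'd) measure topology" where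
  "weak_star_topology = topology_generated_by
     {{\<nu> \<in> prob_measures. (LINT x|\<nu>. f x) \<in> U} | (f :: real ^ 'd \<Rightarrow> real) U.
        continuous_on unit_cube f \<and> open U}"

definition weak_star_borel :: "(real ^ 'd) measure measure" where
  "weak_star_borel = sigma prob_measures {V. openin weak_star_topology V}"


section \<open>Dyadic cubes\<close>

definition dyadic_cube :: "nat \<Rightarrow> ('d \<Rightarrow> nat) \<Rightarrow> (real ^ 'd) set" where
  "dyadic_cube k z = {x. \<forall>i. real (z i) / 2 ^ k \<le> x $ i \<and>
     (x $ i < real (z i + 1) / 2 ^ k \<or> (z i + 1 = 2 ^ k \<and> x $ i = 1))}"

definition dyadic_cubes :: "nat \<Rightarrow> (real ^ 'd) set set" where
  "dyadic_cubes k = {dyadic_cube k z | z. \<forall>i. z i < 2 ^ k}"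

abbreviation words :: "nat \<Rightarrow> nat list set" where
  "words n \<equiv> lists {1..n}"

text \<open>
  The order in which the children of a dyadic cube are numbered is left open; it may vary from
  cube to cube.
\<close>

definition dyadic_indexing :: "(nat list \<Rightarrow> (real ^ 'd) set) \<Rightarrow> bool" where
  "dyadic_indexing Q \<longleftrightarrow>
     Q [] = unit_cube \<and>
     (\<forall>w \<in> words (2 ^ CARD('d)).
        bij_betw (\<lambda>i. Q (w @ [i])) {1..2 ^ CARD('d)}
          {C \<in> dyadic_cubes (Suc (length w)). C \<subseteq> Q w})"


section \<open>The uniform distribution on the simplex\<close>

abbreviation vec_borel :: "nat \<Rightarrow> (nat \<Rightarrow> real) measure" where
  "vec_borel n \<equiv> PiM {1..n} (\<lambda>_. borel)"

text \<open>
  The simplex \<open>{x. x\<^sub>i \<ge> 0, x\<^sub>1 + \<dots> + x\<^sub>n = 1}\<close> is the graph of the affine function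
  \<open>x\<^sub>n = 1 - (x\<^sub>1 + \<dots> + x\<^bsub>n-1\<^esub>)\<close> over the solid simplex in the first \<open>n - 1\<close> coordinates.
  An affine parametrisation changes \<open>(n-1)\<close>-dimensional volume by a constant factor only, so the
  normalised volume on the simplex is the image of the normalised Lebesgue measure.
\<close>

definition uniform_simplex :: "nat \<Rightarrow> (nat \<Rightarrow> real) measure" where
  "uniform_simplex n =
     (let L = PiM {1..<n} (\<lambda>_. lborel) in
      distr (uniform_measure L {y \<in> space L. (\<forall>i\<in>{1..<n}. y i \<ge> 0) \<and> (\<Sum>i\<in>{1..<n}. y i) \<le> 1})
        (vec_borel n) (\<lambda>y. y(n := 1 - (\<Sum>i\<in>{1..<n}. y i))))"


section \<open>Upper Assouad dimension\<close>

definition supp :: "('a :: topological_space) measure \<Rightarrow> 'a set" where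
  "supp \<nu> = {x \<in> space \<nu>. \<forall>U. open U \<and> x \<in> U \<longrightarrow> emeasure \<nu> (U \<inter> space \<nu>) > 0}"

text \<open>
  The supremum is taken in the extended reals, and \<open>Inf {} = \<infinity>\<close> there. The denominators are
  positive because the centres lie in the support.
\<close>

definition upper_assouad_dim :: "('a :: metric_space) measure \<Rightarrow> ereal" where
  "upper_assouad_dim \<nu> = Inf {ereal s | s :: real. \<exists>C > 0. \<forall>r R. 0 < r \<and> r < R \<and> R < 1 \<longrightarrow>
     (SUP x \<in> supp \<nu>. ereal (measure \<nu> (ball x R \<inter> space \<nu>) / measure \<nu> (ball x r \<inter> space \<nu>)))
       \<le> ereal (C * (R / r) powr s)}"

end

theory Submission
  imports Defs
begin

text \<open>
  At every word \<open>w\<close> the first child \<open>Q\<^bsub>w1\<^esub>\<close> receives less than the fraction \<open>1/m\<close> of the mass of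
  \<open>Q\<^bsub>w\<^esub>\<close> with a probability that is positive and does not depend on \<open>w\<close>. By independence along the
  words \<open>w = 1\<dots>1\<close> this happens almost surely at some small scale, for every \<open>m\<close>. A support point in
  the interior of \<open>Q\<^bsub>w1\<^esub>\<close> exists because all dyadic cubes have positive mass almost surely. Around
  it, a ball inside \<open>Q\<^bsub>w1\<^esub>\<close> and a ball containing \<open>Q\<^bsub>w\<^esub>\<close> have radii with a ratio that depends only
  on \<open>d\<close>, but masses with a ratio exceeding \<open>m\<close>, which rules out every exponent.

  To avoid the question whether the measures of infinite dimension form a measurable set, the law of
  \<open>\<mu>\<close> is tested on a smaller event that involves only the masses of countably many dyadic cubes.
\<close>

section \<open>Measurability of the masses of Borel sets\<close>

lemma openin_weak_star_integral:
  fixes f :: "real ^ 'd \<Rightarrow> real"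
  assumes "continuous_on unit_cube f" "open U"
  shows "openin weak_star_topology {\<nu> \<in> prob_measures. (LINT x|\<nu>. f x) \<in> U}"
  unfolding weak_star_topology_def using assms
  by (intro topology_generated_by_Basis) blast

lemma openin_weak_star_subset:
  assumes "openin weak_star_topology V"
  shows "V \<subseteq> prob_measures"
proof -
  have "V \<subseteq> topspace weak_star_topology"
    using assms by (rule openin_subset)
  also have "\<dots> \<subseteq> prob_measures"
    unfolding weak_star_topology_def topology_generated_by_topspace by auto
  finally show ?thesis .
qed

lemma space_weak_star_borel: "space weak_star_borel = prob_measures"
  unfolding weak_star_borel_def
  by (rule space_measure_of) (use openin_weak_star_subset in blast)

lemma sets_weak_star_borel_openin:
  assumes "openin weak_star_topology V"
  shows "V \<in> sets weak_star_borel"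
proof -
  have "sets (weak_star_borel :: (real ^ 'd) measure measure)
      = sigma_sets prob_measures {V. openin weak_star_topology V}"
    unfolding weak_star_borel_def
    by (rule sets_measure_of) (use openin_weak_star_subset in blast)
  then show ?thesis using assms by auto
qed

lemma measurable_weak_star_integral:
  fixes f :: "real ^ 'd \<Rightarrow> real"
  assumes "continuous_on unit_cube f"
  shows "(\<lambda>\<nu>. LINT x|\<nu>. f x) \<in> borel_measurable weak_star_borel"
proof (rule borel_measurableI)
  fix U :: "real set" assume "open U"
  have "(\<lambda>\<nu>. LINT x|\<nu>. f x) -` U \<inter> space weak_star_borel
      = {\<nu> \<in> prob_measures. (LINT x|\<nu>. f x) \<in> U}"
    by (auto simp: space_weak_star_borel)
  then show "(\<lambda>\<nu>. LINT x|\<nu>. f x) -` U \<inter> space weak_star_borel \<in> sets weak_star_borel"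
    using sets_weak_star_borel_openin[OF openin_weak_star_integral[OF assms \<open>open U\<close>]] by simp
qed

lemma prob_measuresD:
  assumes "\<nu> \<in> prob_measures"
  shows "prob_space \<nu>" "sets \<nu> = sets cube_borel" "space \<nu> = unit_cube"
  using assms sets_eq_imp_space_eq[of \<nu> cube_borel]
  by (auto simp: prob_measures_def space_restrict_space)

text \<open>Supplies continuous functions decreasing to the indicator: off the closed set the
  distance is positive, so multiplying it by a large \<open>m\<close> makes the truncation vanish.
  Nonemptiness matters because \<open>infdist x {}\<close> is 0 by convention, which would make the
  functions constantly 1.\<close>

lemma tendsto_infdist_indicator:
  fixes F :: "'a :: metric_space set"
  assumes "closed F" "F \<noteq> {}"
  shows "(\<lambda>m. max 0 (1 - real m * infdist x F)) \<longlonglongrightarrow> indicator F x"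
proof (cases "x \<in> F")
  case True
  then show ?thesis by simp
next
  case False
  then have pos: "infdist x F > 0"
    using assms in_closed_iff_infdist_zero infdist_nonneg by (metis order_le_less)
  obtain k :: nat where k: "1 < real k * infdist x F"
    using reals_Archimedean3[OF pos] by blast
  have "max 0 (1 - real m * infdist x F) = 0" if "m \<ge> k" for m
  proof -
    have "real k * infdist x F \<le> real m * infdist x F"
      using that pos by (intro mult_right_mono) auto
    then show ?thesis using k by simp
  qed
  then have "eventually (\<lambda>m. max 0 (1 - real m * infdist x F) = 0) sequentially"
    using eventually_at_top_linorder by blast
  then have "(\<lambda>m. max 0 (1 - real m * infdist x F)) \<longlonglongrightarrow> 0"
    by (rule tendsto_eventually)
  then show ?thesis using False by simp
qed

text \<open>The mass is a pointwise limit of integrals of continuous functions, which are measurable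
  by the choice of topology. The limit is taken by dominated convergence with bound 1, integrable
  since \<open>\<nu>\<close> is a probability measure. The empty set is split off because of the
  convention for \<open>infdist\<close>.\<close>

lemma measurable_weak_star_measure_closed:
  fixes F :: "(real ^ 'd) set"
  assumes "closed F"
  shows "(\<lambda>\<nu>. measure \<nu> (F \<inter> unit_cube)) \<in> borel_measurable weak_star_borel"
proof (cases "F = {}")
  case False
  define f where "f m x = max 0 (1 - real m * infdist x F)" for m :: nat and x :: "real ^ 'd"
  have cont: "continuous_on A (f m)" for A m
    unfolding f_def by (intro continuous_intros)
  show ?thesis
  proof (rule borel_measurable_LIMSEQ_real)
    fix m show "(\<lambda>\<nu>. LINT x|\<nu>. f m x) \<in> borel_measurable weak_star_borel"
      using cont by (rule measurable_weak_star_integral)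
  next
    fix \<nu> :: "(real ^ 'd) measure" assume "\<nu> \<in> space weak_star_borel"
    then have \<nu>: "\<nu> \<in> prob_measures" by (simp add: space_weak_star_borel)
    interpret prob_space \<nu> using prob_measuresD[OF \<nu>] by simp
    have meas: "g \<in> borel_measurable \<nu>" if "g \<in> borel_measurable borel"
      for g :: "real ^ 'd \<Rightarrow> real"
      using measurable_restrict_space1[OF that] prob_measuresD(2)[OF \<nu>]
      by (simp cong: measurable_cong_sets)
    have F: "F \<in> sets borel" using assms by simp
    have "(\<lambda>m. LINT x|\<nu>. f m x) \<longlonglongrightarrow> (LINT x|\<nu>. indicator F x)"
    proof (rule integral_dominated_convergence[where w = "\<lambda>_. 1"])
      show "indicat_real F \<in> borel_measurable \<nu>" using F by (intro meas) simp
      show "f m \<in> borel_measurable \<nu>" for m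
        using cont by (intro meas borel_measurable_continuous_onI)
      show "AE x in \<nu>. (\<lambda>m. f m x) \<longlonglongrightarrow> indicat_real F x"
        unfolding f_def using tendsto_infdist_indicator[OF assms False] by simp
      show "AE x in \<nu>. norm (f m x) \<le> 1" for m
        unfolding f_def by (auto simp: infdist_nonneg)
    qed simp
    then show "(\<lambda>m. LINT x|\<nu>. f m x) \<longlonglongrightarrow> measure \<nu> (F \<inter> unit_cube)"
      by (simp add: prob_measuresD[OF \<nu>])
  qed
qed simp

text \<open>Dynkin's argument: closed sets are stable under intersection and generate the Borel
  sets, and measurability of the mass passes to complements (the total mass is the constant 1) and
  to countable disjoint unions (a series of masses).\<close>

lemma measurable_weak_star_measure:
  fixes A :: "(real ^ 'd) set"
  assumes "A \<in> sets borel"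
  shows "(\<lambda>\<nu>. measure \<nu> (A \<inter> unit_cube)) \<in> borel_measurable weak_star_borel"
proof -
  have "Int_stable (Collect closed :: (real ^ 'd) set set)"
    by (auto simp: Int_stable_def)
  moreover have "Collect closed \<subseteq> Pow (UNIV :: (real ^ 'd) set)" by simp
  moreover have "A \<in> sigma_sets UNIV (Collect closed)"
    using assms by (simp add: borel_eq_closed)
  ultimately show ?thesis
  proof (induction rule: sigma_sets_induct_disjoint)
    case (basic A)
    then show ?case by (auto intro: measurable_weak_star_measure_closed)
  next
    case empty
    then show ?case by simp
  next
    case (compl A)
    then have A: "A \<in> sets borel" by (simp add: borel_eq_closed)
    have eq: "measure \<nu> ((UNIV - A) \<inter> unit_cube) = 1 - measure \<nu> (A \<inter> unit_cube)"
      if "\<nu> \<in> space weak_star_borel" for \<nu> :: "(real ^ 'd) measure"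
    proof -
      have \<nu>: "\<nu> \<in> prob_measures" using that by (simp add: space_weak_star_borel)
      interpret prob_space \<nu> using prob_measuresD[OF \<nu>] by simp
      have "A \<inter> unit_cube \<in> sets \<nu>"
        using A by (auto simp: prob_measuresD[OF \<nu>] sets_restrict_space)
      moreover have "(UNIV - A) \<inter> unit_cube = space \<nu> - A \<inter> unit_cube"
        by (auto simp: prob_measuresD[OF \<nu>])
      ultimately show ?thesis by (simp only: prob_compl)
    qed
    have "(\<lambda>\<nu>. 1 - measure \<nu> (A \<inter> unit_cube)) \<in> borel_measurable weak_star_borel"
      using compl by (intro borel_measurable_diff) auto
    then show ?case
      by (subst measurable_cong[where g = "\<lambda>\<nu>. 1 - measure \<nu> (A \<inter> unit_cube)"]) (simp_all add: eq)
  next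
    case (union A)
    then have A: "A i \<in> sets borel" for i by (auto simp: borel_eq_closed)
    have eq: "measure \<nu> ((\<Union>i. A i) \<inter> unit_cube) = (\<Sum>i. measure \<nu> (A i \<inter> unit_cube))"
      if "\<nu> \<in> space weak_star_borel" for \<nu> :: "(real ^ 'd) measure"
    proof -
      have \<nu>: "\<nu> \<in> prob_measures" using that by (simp add: space_weak_star_borel)
      interpret prob_space \<nu> using prob_measuresD[OF \<nu>] by simp
      have "range (\<lambda>i. A i \<inter> unit_cube) \<subseteq> sets \<nu>"
        using A by (auto simp: prob_measuresD[OF \<nu>] sets_restrict_space)
      moreover have "disjoint_family (\<lambda>i. A i \<inter> unit_cube)"
        using union(1) by (auto simp: disjoint_family_on_def)
      ultimately have "(\<lambda>i. measure \<nu> (A i \<inter> unit_cube)) sums measure \<nu> (\<Union>i. A i \<inter> unit_cube)"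
        by (rule finite_measure_UNION)
      then show ?thesis by (simp add: sums_iff)
    qed
    have "(\<lambda>\<nu>. \<Sum>i. measure \<nu> (A i \<inter> unit_cube)) \<in> borel_measurable weak_star_borel"
      using union(3) by (rule borel_measurable_suminf)
    then show ?case
      by (subst measurable_cong[where g = "\<lambda>\<nu>. \<Sum>i. measure \<nu> (A i \<inter> unit_cube)"])
        (simp_all add: eq)
  qed
qed


section \<open>Dyadic geometry\<close>

lemma dyadic_cube_borel: "dyadic_cube k z \<in> sets (borel :: (real ^ 'd) measure)"
proof -
  have "dyadic_cube k z = {x \<in> space borel. \<forall>i. real (z i) / 2 ^ k \<le> x $ i \<and>
     (x $ i < real (z i + 1) / 2 ^ k \<or> (z i + 1 = 2 ^ k \<and> x $ i = 1))}"
    by (simp add: dyadic_cube_def)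
  also have "\<dots> \<in> sets borel" by measurable
  finally show ?thesis .
qed

lemma dyadic_cube_coord:
  assumes "x \<in> dyadic_cube k z"
  shows "real (z i) / 2 ^ k \<le> x $ i" "x $ i \<le> real (z i + 1) / 2 ^ k"
proof -
  show "real (z i) / 2 ^ k \<le> x $ i" using assms by (simp add: dyadic_cube_def)
  \<comment> \<open>The extra closed face at coordinate 1 also obeys the upper bound, since the
    right endpoint is then exactly 1.\<close>
  have "real (z i + 1) / 2 ^ k = 1" if "z i + 1 = 2 ^ k"
    unfolding that by simp
  then show "x $ i \<le> real (z i + 1) / 2 ^ k"
    using assms by (auto simp: dyadic_cube_def simp del: of_nat_add of_nat_Suc dest!: spec[of _ i])
qed

lemma dyadic_cube_subset_unit_cube:
  fixes z :: "'d :: finite \<Rightarrow> nat"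
  assumes "\<forall>i. z i < 2 ^ k"
  shows "dyadic_cube k z \<subseteq> unit_cube"
proof
  fix x assume x: "x \<in> dyadic_cube k z"
  have "0 \<le> x $ i \<and> x $ i \<le> 1" for i
  proof -
    have "z i + 1 \<le> 2 ^ k" using assms by (simp add: Suc_leI)
    then have "real (z i + 1) \<le> 2 ^ k"
      using of_nat_mono[of "z i + 1" "2 ^ k", where 'a = real] by simp
    then have "real (z i + 1) / 2 ^ k \<le> 1" by simp
    moreover have "0 \<le> real (z i) / 2 ^ k" by simp
    ultimately show ?thesis
      using dyadic_cube_coord[OF x, of i] by linarith
  qed
  then show "x \<in> unit_cube" by (simp add: mem_box_cart)
qed

lemma dyadic_cube_dist:
  fixes x y :: "real ^ 'd"
  assumes "x \<in> dyadic_cube k z" "y \<in> dyadic_cube k z"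
  shows "dist x y \<le> real CARD('d) / 2 ^ k"
proof -
  have "\<bar>(x - y) $ i\<bar> \<le> 1 / 2 ^ k" for i
  proof -
    have "real (z i + 1) / 2 ^ k = real (z i) / 2 ^ k + 1 / 2 ^ k"
      by (simp add: add_divide_distrib)
    then show ?thesis
      using dyadic_cube_coord[OF assms(1), of i] dyadic_cube_coord[OF assms(2), of i]
      by (simp add: abs_le_iff)
  qed
  \<comment> \<open>Bounding the Euclidean norm by the sum of the coordinates gives the crude factor
    \<open>d\<close> instead of its square root; only its independence of \<open>k\<close> matters
    later.\<close>
  then have "norm (x - y) \<le> (\<Sum>i\<in>(UNIV :: 'd set). 1 / 2 ^ k)"
    by (intro order_trans[OF norm_le_l1_cart] sum_mono)
  then show ?thesis by (simp add: dist_norm)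
qed

lemma dyadic_cube_double_subset: "dyadic_cube (Suc k) (\<lambda>i. 2 * z i) \<subseteq> dyadic_cube k z"
proof
  fix x assume x: "x \<in> dyadic_cube (Suc k) (\<lambda>i. 2 * z i)"
  have "real (z i) / 2 ^ k \<le> x $ i \<and> x $ i < real (z i + 1) / 2 ^ k" for i
  proof -
    \<comment> \<open>By parity the lower half of an interval never ends at 1, so its right end is
      always open and the exceptional face does not occur.\<close>
    have "2 * z i + 1 \<noteq> 2 ^ Suc k" by (metis even_add even_mult_iff even_numeral odd_one power_Suc)
    then have "real (2 * z i) / 2 ^ Suc k \<le> x $ i" "x $ i < real (2 * z i + 1) / 2 ^ Suc k"
      using x by (auto simp: dyadic_cube_def dest!: spec[of _ i])
    moreover have "real (2 * z i + 1) / 2 ^ Suc k \<le> real (z i + 1) / 2 ^ k"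
      by (simp add: field_simps)
    moreover have "real (2 * z i) / 2 ^ Suc k = real (z i) / 2 ^ k" by simp
    ultimately show ?thesis by linarith
  qed
  then show "x \<in> dyadic_cube k z" by (simp add: dyadic_cube_def)
qed

lemma dyadic_cube_double_Suc_subset:
  "dyadic_cube (Suc k) (\<lambda>i. Suc (2 * z i)) \<subseteq> dyadic_cube k z"
proof
  fix x assume x: "x \<in> dyadic_cube (Suc k) (\<lambda>i. Suc (2 * z i))"
  have "real (z i) / 2 ^ k \<le> x $ i \<and>
     (x $ i < real (z i + 1) / 2 ^ k \<or> (z i + 1 = 2 ^ k \<and> x $ i = 1))" for i
  proof -
    \<comment> \<open>The upper half ends at 1 exactly when its parent does, so the exceptional
      closed faces correspond.\<close>
    have "Suc (2 * z i) + 1 = 2 ^ Suc k \<longleftrightarrow> z i + 1 = 2 ^ k" by auto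
    then have "real (Suc (2 * z i)) / 2 ^ Suc k \<le> x $ i"
      "x $ i < real (Suc (2 * z i) + 1) / 2 ^ Suc k \<or> (z i + 1 = 2 ^ k \<and> x $ i = 1)"
      using x by (auto simp: dyadic_cube_def dest!: spec[of _ i])
    moreover have "real (Suc (2 * z i) + 1) / 2 ^ Suc k = real (z i + 1) / 2 ^ k"
      by (simp add: field_simps)
    moreover have "real (z i) / 2 ^ k \<le> real (Suc (2 * z i)) / 2 ^ Suc k"
      by (simp add: field_simps)
    ultimately show ?thesis by auto
  qed
  then show "x \<in> dyadic_cube k z" by (simp add: dyadic_cube_def)
qed

text \<open>
  In every coordinate the quarter with index \<open>4z + 1\<close> keeps a distance of at least one quarter of
  the side length from the boundary of the interval with index \<open>z\<close>.
\<close>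

lemma ball_subset_dyadic_cube:
  fixes x :: "real ^ 'd"
  assumes "x \<in> dyadic_cube (Suc (Suc k)) (\<lambda>i. Suc (2 * (2 * z i)))"
  shows "ball x (1 / 2 ^ (k + 2)) \<subseteq> dyadic_cube k z"
proof
  fix y assume y: "y \<in> ball x (1 / 2 ^ (k + 2))"
  have "real (z i) / 2 ^ k \<le> y $ i \<and> y $ i < real (z i + 1) / 2 ^ k" for i
  proof -
    have "\<bar>(x - y) $ i\<bar> < 1 / 2 ^ (k + 2)"
      using y component_le_norm_cart[of "x - y" i] by (simp add: dist_norm)
    moreover have "real (Suc (2 * (2 * z i))) / 2 ^ Suc (Suc k) = real (z i) / 2 ^ k + 1 / 2 ^ (k + 2)"
      "real (Suc (2 * (2 * z i)) + 1) / 2 ^ Suc (Suc k) = real (z i) / 2 ^ k + 2 * (1 / 2 ^ (k + 2))"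
      "real (z i + 1) / 2 ^ k = real (z i) / 2 ^ k + 4 * (1 / 2 ^ (k + 2))"
      by (simp_all add: field_simps)
    moreover have "(1 :: real) / 2 ^ (k + 2) > 0" by simp
    ultimately show ?thesis
      using dyadic_cube_coord[OF assms, of i] by (simp only: vector_minus_component) linarith
  qed
  then show "y \<in> dyadic_cube k z" by (simp add: dyadic_cube_def)
qed

lemma dyadic_indexing_child:
  fixes Q :: "nat list \<Rightarrow> (real ^ 'd) set"
  assumes "dyadic_indexing Q" "w \<in> words (2 ^ CARD('d))"
    "C \<in> dyadic_cubes (Suc (length w))" "C \<subseteq> Q w"
  obtains i where "i \<in> {1..2 ^ CARD('d)}" "Q (w @ [i]) = C"
proof -
  have "bij_betw (\<lambda>i. Q (w @ [i])) {1..2 ^ CARD('d)}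
          {C \<in> dyadic_cubes (Suc (length w)). C \<subseteq> Q w}"
    using assms by (simp add: dyadic_indexing_def)
  then have "(\<lambda>i. Q (w @ [i])) ` {1..2 ^ CARD('d)} = {C \<in> dyadic_cubes (Suc (length w)). C \<subseteq> Q w}"
    by (rule bij_betw_imp_surj_on)
  then have "C \<in> (\<lambda>i. Q (w @ [i])) ` {1..2 ^ CARD('d)}"
    using assms(3,4) by blast
  then show thesis using that by blast
qed

lemma dyadic_indexing_cube:
  fixes Q :: "nat list \<Rightarrow> (real ^ 'd) set"
  assumes "dyadic_indexing Q" "w \<in> words (2 ^ CARD('d))"
  shows "Q w \<in> dyadic_cubes (length w)"
proof (cases w rule: rev_cases)
  case Nil
  have "unit_cube = dyadic_cube 0 ((\<lambda>_. 0) :: 'd \<Rightarrow> nat)"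
    by (auto simp: dyadic_cube_def mem_box_cart less_eq_real_def)
  then show ?thesis
    using assms Nil by (auto simp: dyadic_indexing_def dyadic_cubes_def)
next
  case (snoc v i)
  then have "bij_betw (\<lambda>i. Q (v @ [i])) {1..2 ^ CARD('d)}
          {C \<in> dyadic_cubes (Suc (length v)). C \<subseteq> Q v}"
    using assms by (simp add: dyadic_indexing_def)
  then show ?thesis
    using bij_betwE snoc assms(2) by fastforce
qed

text \<open>Two generations suffice: the child with indices \<open>2z\<close>, then its child with
  indices \<open>4z + 1\<close>. As every child of a cube is the image of some letter, both have
  words, whatever the numbering. Mass in \<open>Q v\<close> then yields a support point well inside
  \<open>Q w\<close>.\<close>

lemma dyadic_indexing_inner_cube:
  fixes Q :: "nat list \<Rightarrow> (real ^ 'd) set"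
  assumes "dyadic_indexing Q" "w \<in> words (2 ^ CARD('d))"
  obtains v where "v \<in> words (2 ^ CARD('d))"
    "\<And>x. x \<in> Q v \<Longrightarrow> ball x (1 / 2 ^ (length w + 2)) \<subseteq> Q w"
proof -
  define k where "k = length w"
  obtain z where z: "Q w = dyadic_cube k z" "\<forall>i. z i < 2 ^ k"
    using dyadic_indexing_cube[OF assms] by (auto simp: dyadic_cubes_def k_def)
  have "dyadic_cube (Suc k) (\<lambda>i. 2 * z i) \<in> dyadic_cubes (Suc (length w))"
    using z(2) by (auto simp: dyadic_cubes_def k_def)
  from dyadic_indexing_child[OF assms this]
  obtain a where a: "a \<in> {1..2 ^ CARD('d)}" "Q (w @ [a]) = dyadic_cube (Suc k) (\<lambda>i. 2 * z i)"
    using dyadic_cube_double_subset z(1) by metis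
  have wa: "w @ [a] \<in> words (2 ^ CARD('d))" using assms(2) a(1) by simp
  have "Suc (2 * (2 * z i)) < 2 ^ Suc (Suc k)" for i
    using z(2)[rule_format, of i] by simp
  then have "dyadic_cube (Suc (Suc k)) (\<lambda>i. Suc (2 * (2 * z i)))
      \<in> dyadic_cubes (Suc (length (w @ [a])))"
    unfolding dyadic_cubes_def k_def by auto
  from dyadic_indexing_child[OF assms(1) wa this]
  obtain b where b: "b \<in> {1..2 ^ CARD('d)}"
    "Q ((w @ [a]) @ [b]) = dyadic_cube (Suc (Suc k)) (\<lambda>i. Suc (2 * (2 * z i)))"
    using dyadic_cube_double_Suc_subset[of "Suc k"] a(2) by metis
  show thesis
  proof
    show "(w @ [a]) @ [b] \<in> words (2 ^ CARD('d))" using wa b(1) by simp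
    show "ball x (1 / 2 ^ (length w + 2)) \<subseteq> Q w" if "x \<in> Q ((w @ [a]) @ [b])" for x
      using ball_subset_dyadic_cube[of x k z] that by (simp only: b z(1) k_def)
  qed
qed

lemma dyadic_indexing_dist:
  fixes Q :: "nat list \<Rightarrow> (real ^ 'd) set"
  assumes "dyadic_indexing Q" "w \<in> words (2 ^ CARD('d))" "x \<in> Q w" "y \<in> Q w"
  shows "dist x y \<le> real CARD('d) / 2 ^ length w"
  using dyadic_indexing_cube[OF assms(1,2)] assms(3,4) dyadic_cube_dist
  by (fastforce simp: dyadic_cubes_def)

lemma dyadic_indexing_borel:
  fixes Q :: "nat list \<Rightarrow> (real ^ 'd) set"
  assumes "dyadic_indexing Q" "w \<in> words (2 ^ CARD('d))"
  shows "Q w \<in> sets borel" "Q w \<subseteq> unit_cube"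
  using dyadic_indexing_cube[OF assms] dyadic_cube_borel dyadic_cube_subset_unit_cube
  by (fastforce simp: dyadic_cubes_def)+

lemma dyadic_indexing_child_subset:
  fixes Q :: "nat list \<Rightarrow> (real ^ 'd) set"
  assumes "dyadic_indexing Q" "w @ [i] \<in> words (2 ^ CARD('d))"
  shows "Q (w @ [i]) \<subseteq> Q w"
proof -
  have "bij_betw (\<lambda>i. Q (w @ [i])) {1..2 ^ CARD('d)}
          {C \<in> dyadic_cubes (Suc (length w)). C \<subseteq> Q w}"
    using assms by (simp add: dyadic_indexing_def)
  then show ?thesis using bij_betwE assms(2) by fastforce
qed


section \<open>Support and dimension\<close>

text \<open>The complement of the support is null: it is covered by open sets of measure zero, and
  by the Lindelof property countably many of them suffice.\<close>

lemma supp_Int_nonempty: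
  fixes \<nu> :: "'a :: second_countable_topology measure"
  assumes sets: "sets \<nu> = sets (restrict_space borel S)"
    and A: "A \<in> sets \<nu>" "emeasure \<nu> A > 0"
  shows "supp \<nu> \<inter> A \<noteq> {}"
proof
  assume *: "supp \<nu> \<inter> A = {}"
  have space: "space \<nu> = S"
    using sets_eq_imp_space_eq[OF sets] by (simp add: space_restrict_space)
  have open_sets: "U \<inter> space \<nu> \<in> sets \<nu>" if "open U" for U
    using that by (auto simp: sets space sets_restrict_space)
  define \<U> where "\<U> = {U. open U \<and> emeasure \<nu> (U \<inter> space \<nu>) = 0}"
  obtain \<V> where \<V>: "\<V> \<subseteq> \<U>" "countable \<V>" "\<Union>\<V> = \<Union>\<U>"
    by (rule Lindelof[of \<U>]) (auto simp: \<U>_def)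
  have "A \<subseteq> (\<Union>U\<in>\<V>. U \<inter> space \<nu>)"
  proof
    fix x assume "x \<in> A"
    then have x: "x \<in> space \<nu>" "x \<notin> supp \<nu>"
      using A(1) sets.sets_into_space * by blast+
    then obtain U where "open U" "x \<in> U" "emeasure \<nu> (U \<inter> space \<nu>) = 0"
      by (auto simp: supp_def)
    then have "x \<in> \<Union>\<V>" unfolding \<V>(3) \<U>_def by blast
    then show "x \<in> (\<Union>U\<in>\<V>. U \<inter> space \<nu>)" using x(1) by blast
  qed
  moreover have "(\<Union>U\<in>\<V>. U \<inter> space \<nu>) \<in> null_sets \<nu>"
    using \<V> open_sets by (intro null_sets_UN') (auto simp: \<U>_def null_sets_def)
  ultimately have "emeasure \<nu> A = 0"
    using A(1) null_sets_subset by (metis null_setsD1)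
  then show False using A(2) by simp
qed

text \<open>At one fixed ratio \<open>c\<close> of radii the bound \<open>C * c powr s\<close> is a
  constant, so mass ratios exceeding every \<open>m\<close> exclude each exponent \<open>s\<close>,
  and the infimum is taken over the empty set.\<close>

lemma upper_assouad_dim_infinite:
  fixes \<nu> :: "'a :: metric_space measure"
  assumes "finite_measure \<nu>"
    and ex: "\<And>m :: nat. \<exists>x \<in> supp \<nu>. \<exists>r R. 0 < r \<and> r < R \<and> R < 1 \<and> R / r = c \<and>
      m * measure \<nu> (ball x r \<inter> space \<nu>) < measure \<nu> (ball x R \<inter> space \<nu>)"
  shows "upper_assouad_dim \<nu> = \<infinity>"
proof -
  interpret finite_measure \<nu> by fact
  have False
    if C: "C > 0" "\<forall>r R. 0 < r \<and> r < R \<and> R < 1 \<longrightarrow>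
      (SUP x \<in> supp \<nu>. ereal (measure \<nu> (ball x R \<inter> space \<nu>) / measure \<nu> (ball x r \<inter> space \<nu>)))
       \<le> ereal (C * (R / r) powr s)" for C s :: real
  proof -
    obtain m :: nat where m: "C * c powr s < m" using reals_Archimedean2 by blast
    obtain x r R where x: "x \<in> supp \<nu>" and r: "0 < r" "r < R" "R < 1" "R / r = c"
      and less: "m * measure \<nu> (ball x r \<inter> space \<nu>) < measure \<nu> (ball x R \<inter> space \<nu>)"
      using ex[of m] by blast
    \<comment> \<open>A quotient by zero would be 0 and give no contradiction; the denominator is
      positive because the centre lies in the support.\<close>
    have "emeasure \<nu> (ball x r \<inter> space \<nu>) > 0"
      using x r(1) by (auto simp: supp_def)
    then have pos: "measure \<nu> (ball x r \<inter> space \<nu>) > 0"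
      by (simp add: emeasure_eq_measure)
    have "ereal (measure \<nu> (ball x R \<inter> space \<nu>) / measure \<nu> (ball x r \<inter> space \<nu>))
        \<le> (SUP x \<in> supp \<nu>. ereal (measure \<nu> (ball x R \<inter> space \<nu>) / measure \<nu> (ball x r \<inter> space \<nu>)))"
      using x by (rule SUP_upper)
    also have "\<dots> \<le> ereal (C * (R / r) powr s)" using C(2) r by blast
    finally have "measure \<nu> (ball x R \<inter> space \<nu>) / measure \<nu> (ball x r \<inter> space \<nu>) < m"
      using m r(4) by simp
    then show False using less pos by (simp add: field_simps)
  qed
  then have "{ereal s | s :: real. \<exists>C > 0. \<forall>r R. 0 < r \<and> r < R \<and> R < 1 \<longrightarrow>
     (SUP x \<in> supp \<nu>. ereal (measure \<nu> (ball x R \<inter> space \<nu>) / measure \<nu> (ball x r \<inter> space \<nu>)))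
       \<le> ereal (C * (R / r) powr s)} = {}"
    by blast
  then show ?thesis unfolding upper_assouad_dim_def by (simp only: Inf_empty top_ereal_def)
qed

text \<open>Trades balls and the support for masses of dyadic cubes. The word \<open>core w\<close>
  names a cube deep inside \<open>Q (w @ [1])\<close>; its positive mass provides a support point
  there to serve as the centre.\<close>

lemma upper_assouad_dim_infinite_dyadic:
  fixes Q :: "nat list \<Rightarrow> (real ^ 'd) set"
  assumes Q: "dyadic_indexing Q" and \<nu>: "\<nu> \<in> prob_measures"
    and core: "\<And>w x. w \<in> W \<Longrightarrow> x \<in> Q (core w) \<Longrightarrow> ball x (1 / 2 ^ (length w + 3)) \<subseteq> Q (w @ [1])"
    and words: "\<And>w. w \<in> W \<Longrightarrow> w @ [1] \<in> words (2 ^ CARD('d)) \<and> core w \<in> words (2 ^ CARD('d))"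
    and ex: "\<And>m :: nat. \<exists>w \<in> W. length w > CARD('d) \<and> measure \<nu> (Q (core w)) > 0 \<and>
      m * measure \<nu> (Q (w @ [1])) < measure \<nu> (Q w)"
  shows "upper_assouad_dim \<nu> = \<infinity>"
proof (rule upper_assouad_dim_infinite[where c = "16 * real CARD('d)"])
  interpret prob_space \<nu> using prob_measuresD[OF \<nu>] by simp
  show "finite_measure \<nu>" by (rule finite_measure_axioms)
  have sets: "A \<inter> unit_cube \<in> sets \<nu>" if "A \<in> sets borel" for A
    using that by (auto simp: prob_measuresD[OF \<nu>] sets_restrict_space)
  fix m :: nat
  obtain w where w: "w \<in> W" "length w > CARD('d)" "measure \<nu> (Q (core w)) > 0"
      "m * measure \<nu> (Q (w @ [1])) < measure \<nu> (Q w)"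
    using ex by blast
  have w1: "w @ [1] \<in> words (2 ^ CARD('d))" and v: "core w \<in> words (2 ^ CARD('d))"
    using words[OF w(1)] by auto
  then have w0: "w \<in> words (2 ^ CARD('d))" by simp
  have Qsets: "Q u \<in> sets \<nu>" if "u \<in> words (2 ^ CARD('d))" for u
    using sets[OF dyadic_indexing_borel(1)[OF Q that]] dyadic_indexing_borel(2)[OF Q that]
    by (simp add: inf.absorb1)
  have "supp \<nu> \<inter> Q (core w) \<noteq> {}"
    using prob_measuresD(2)[OF \<nu>] Qsets[OF v] w(3)
    by (intro supp_Int_nonempty) (auto simp: emeasure_eq_measure)
  then obtain x where x: "x \<in> supp \<nu>" "x \<in> Q (core w)" by blast
  \<comment> \<open>\<open>r\<close> is a quarter of the side length of \<open>Q (w @ [1])\<close>.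
    \<open>R\<close> is twice the diameter bound for \<open>Q w\<close>, the factor 2 giving the
    strict inequality required by open balls.\<close>
  define r where "r = (1 :: real) / 2 ^ (length w + 3)"
  define R where "R = 2 * real CARD('d) / 2 ^ length w"
  have r: "0 < r" by (simp add: r_def)
  have card: "real CARD('d) \<ge> 1" by (simp add: Suc_leI)
  have ball_r: "ball x r \<subseteq> Q (w @ [1])" using core[OF w(1) x(2)] by (simp add: r_def)
  have Rr: "R / r = 16 * real CARD('d)"
    by (simp add: R_def r_def power_add)
  have "R = 16 * real CARD('d) * r" using Rr r by (simp add: field_simps)
  then have "r < R" using r card by (smt (verit) mult_less_cancel_right1)
  \<comment> \<open>This is the purpose of \<open>length w > CARD('d)\<close>: it gives
    \<open>2 * d < 2 ^ (d + 1) \<le> 2 ^ length w\<close>, where \<open>d\<close> is the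
    dimension.\<close>
  have "R < 1"
  proof -
    have "2 * CARD('d) < 2 * 2 ^ CARD('d)" by simp
    also have "2 * 2 ^ CARD('d) = (2 :: nat) ^ Suc CARD('d)" by simp
    also have "\<dots> \<le> 2 ^ length w" using w(2) by (intro power_increasing) auto
    finally have "real (2 * CARD('d)) < real (2 ^ length w)" by (rule of_nat_less_iff[THEN iffD2])
    then show ?thesis by (simp add: R_def)
  qed
  have "Q w \<subseteq> ball x R"
  proof
    fix y assume y: "y \<in> Q w"
    have "x \<in> Q w"
      using ball_r r dyadic_indexing_child_subset[OF Q w1] by (meson centre_in_ball subsetD)
    then have "dist x y \<le> real CARD('d) / 2 ^ length w"
      using y by (rule dyadic_indexing_dist[OF Q w0])
    also have "\<dots> < R" using card by (simp add: R_def divide_strict_right_mono)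
    finally show "y \<in> ball x R" by simp
  qed
  then have "measure \<nu> (Q w) \<le> measure \<nu> (ball x R \<inter> space \<nu>)"
    using dyadic_indexing_borel(2)[OF Q w0] sets[of "ball x R"]
    by (intro finite_measure_mono) (auto simp: prob_measuresD[OF \<nu>])
  moreover have "measure \<nu> (ball x r \<inter> space \<nu>) \<le> measure \<nu> (Q (w @ [1]))"
    using ball_r Qsets[OF w1] by (intro finite_measure_mono) auto
  then have "m * measure \<nu> (ball x r \<inter> space \<nu>) \<le> m * measure \<nu> (Q (w @ [1]))"
    by (rule mult_left_mono) simp
  ultimately have "m * measure \<nu> (ball x r \<inter> space \<nu>) < measure \<nu> (ball x R \<inter> space \<nu>)"
    using w(4) by linarith
  then show "\<exists>x \<in> supp \<nu>. \<exists>r R. 0 < r \<and> r < R \<and> R < 1 \<and> R / r = 16 * real CARD('d) \<and>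
      m * measure \<nu> (ball x r \<inter> space \<nu>) < measure \<nu> (ball x R \<inter> space \<nu>)"
    using x(1) r \<open>r < R\<close> \<open>R < 1\<close> Rr by blast
qed


section \<open>The uniform distribution on the simplex\<close>

text \<open>The exceptional set is the graph of \<open>h\<close> over the coordinates other than
  \<open>i\<close>. Integrating over coordinate \<open>i\<close> first, each slice is at most a
  single point, hence Lebesgue-null.\<close>

lemma AE_PiM_lborel_coord_neq:
  fixes h :: "('i \<Rightarrow> real) \<Rightarrow> real"
  assumes "finite I" "i \<in> I" and h: "h \<in> borel_measurable (PiM I (\<lambda>_. lborel))"
    and indep: "\<And>y t. h (y(i := t)) = h y"
  shows "AE y in PiM I (\<lambda>_. lborel). y i \<noteq> h y"
proof -
  interpret product_sigma_finite "\<lambda>_ :: 'i. lborel :: real measure" ..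
  let ?L = "PiM I (\<lambda>_. lborel :: real measure)"
  let ?A = "{y \<in> space ?L. y i = h y}"
  have A: "?A \<in> sets ?L"
    using h assms(2) by measurable
  have I: "insert i (I - {i}) = I" using assms(2) by blast
  have "emeasure ?L ?A = (\<integral>\<^sup>+y. indicator ?A y \<partial>PiM (insert i (I - {i})) (\<lambda>_. lborel))"
    unfolding I using A by (simp only: nn_integral_indicator)
  also have "\<dots> = (\<integral>\<^sup>+y. (\<integral>\<^sup>+t. indicator ?A (y(i := t)) \<partial>lborel) \<partial>PiM (I - {i}) (\<lambda>_. lborel))"
    using assms(1) A by (subst product_nn_integral_insert) (simp_all add: I insert_absorb assms(2))
  also have "\<dots> \<le> (\<integral>\<^sup>+y. (\<integral>\<^sup>+t. indicator {h y} t \<partial>lborel) \<partial>PiM (I - {i}) (\<lambda>_. lborel))"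
    by (intro nn_integral_mono) (auto simp: indep split: split_indicator)
  also have "\<dots> = 0" by simp
  finally have "emeasure ?L ?A = 0" by simp
  then show ?thesis using A by (intro AE_I[of _ _ ?A]) auto
qed

context
  fixes n :: nat and L :: "(nat \<Rightarrow> real) measure" and S :: "(nat \<Rightarrow> real) set"
    and T :: "(nat \<Rightarrow> real) \<Rightarrow> nat \<Rightarrow> real"
  defines "L \<equiv> PiM {1..<n} (\<lambda>_. lborel)"
    and "S \<equiv> {y \<in> space L. (\<forall>i\<in>{1..<n}. y i \<ge> 0) \<and> (\<Sum>i\<in>{1..<n}. y i) \<le> 1}"
    and "T \<equiv> \<lambda>y. y(n := 1 - (\<Sum>i\<in>{1..<n}. y i))"
begin

lemma uniform_simplex_eq: "uniform_simplex n = distr (uniform_measure L S) (vec_borel n) T"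
  by (simp add: uniform_simplex_def Let_def L_def S_def T_def)

lemma simplex_coord_measurable [measurable]: "i \<in> {1..<n} \<Longrightarrow> (\<lambda>y. y i) \<in> borel_measurable L"
  unfolding L_def by measurable

lemma sets_simplex [measurable]: "S \<in> sets L"
  unfolding S_def by measurable

lemma simplex_map_measurable:
  assumes "n > 0"
  shows "T \<in> measurable L (vec_borel n)"
proof -
  have n: "{1..n} = insert n {1..<n}" using assms by auto
  have "(\<lambda>y. y(n := 1 - (\<Sum>i\<in>{1..<n}. y i))) \<in> measurable L (PiM (insert n {1..<n}) (\<lambda>_. borel))"
  proof (rule measurable_fun_upd)
    show "insert n {1..<n} = {1..<n} \<union> {n}" by auto
    show "(\<lambda>y. y) \<in> measurable L (PiM {1..<n} (\<lambda>_. borel))"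
      unfolding L_def by (rule measurable_ident_sets) (intro sets_PiM_cong refl sets_lborel)
    show "(\<lambda>y. 1 - (\<Sum>i\<in>{1..<n}. y i)) \<in> borel_measurable L" by measurable
  qed
  then show ?thesis unfolding T_def n .
qed

text \<open>The solid simplex lies in the unit box. Finiteness is needed because the uniform measure
  divides by this volume.\<close>

lemma emeasure_simplex_finite: "emeasure L S < \<infinity>"
proof -
  interpret product_sigma_finite "\<lambda>_ :: nat. lborel :: real measure" ..
  have "S \<subseteq> PiE {1..<n} (\<lambda>_. {0..1})"
  proof
    fix y assume y: "y \<in> S"
    have "y i \<le> 1" if "i \<in> {1..<n}" for i
    proof -
      have "y i \<le> (\<Sum>i\<in>{1..<n}. y i)"
        using y that by (intro member_le_sum) (auto simp: S_def)
      then show ?thesis using y by (simp add: S_def)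
    qed
    then show "y \<in> PiE {1..<n} (\<lambda>_. {0..1})"
      using y by (auto simp: S_def L_def space_PiM PiE_iff)
  qed
  then have "emeasure L S \<le> emeasure L (PiE {1..<n} (\<lambda>_. {0..1}))"
    unfolding L_def by (intro emeasure_mono) auto
  also have "\<dots> = 1"
    unfolding L_def by (subst emeasure_PiM) auto
  finally show ?thesis by (simp add: order_le_less_trans)
qed

lemma emeasure_simplex_small_coord_pos:
  assumes n: "n \<ge> 2" and \<epsilon>: "\<epsilon> > 0"
  shows "emeasure L (S \<inter> {y \<in> space L. y 1 < \<epsilon>}) > 0"
proof -
  interpret product_sigma_finite "\<lambda>_ :: nat. lborel :: real measure" ..
  \<comment> \<open>The box with sides \<open>[0, \<delta>]\<close> fits into the set:
    \<open>\<epsilon> / 2\<close> makes the first coordinate strictly less than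
    \<open>\<epsilon>\<close>, and \<open>1 / n\<close> keeps the coordinate sum at most 1.\<close>
  define \<delta> where "\<delta> = min (\<epsilon> / 2) (1 / n)"
  have \<delta>: "\<delta> > 0" "\<delta> < \<epsilon>" "n * \<delta> \<le> 1"
    using n \<epsilon> by (auto simp: \<delta>_def min_def field_simps)
  have "PiE {1..<n} (\<lambda>_. {0..\<delta>}) \<subseteq> S \<inter> {y \<in> space L. y 1 < \<epsilon>}"
  proof
    fix y assume y: "y \<in> PiE {1..<n} (\<lambda>_. {0..\<delta>})"
    have "(\<Sum>i\<in>{1..<n}. y i) \<le> real (card {1..<n}) * \<delta>"
      using y by (intro sum_bounded_above) auto
    also have "\<dots> \<le> n * \<delta>" using \<delta> by (intro mult_right_mono) auto
    finally have "(\<Sum>i\<in>{1..<n}. y i) \<le> 1" using \<delta> by linarith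
    moreover have "y 1 \<le> \<delta>" using y n by auto
    ultimately show "y \<in> S \<inter> {y \<in> space L. y 1 < \<epsilon>}"
      using y \<delta> by (auto simp: S_def L_def space_PiM PiE_iff)
  qed
  moreover have "{y \<in> space L. y 1 < \<epsilon>} \<in> sets L" by measurable (use n in auto)
  ultimately have "emeasure L (PiE {1..<n} (\<lambda>_. {0..\<delta>})) \<le> emeasure L (S \<inter> {y \<in> space L. y 1 < \<epsilon>})"
    by (intro emeasure_mono) auto
  moreover have "emeasure L (PiE {1..<n} (\<lambda>_. {0..\<delta>})) > 0"
    unfolding L_def using \<delta> by (subst emeasure_PiM) (auto simp: ennreal_power)
  ultimately show ?thesis by (rule order_less_le_trans[rotated])
qed

lemma uniform_simplex_small_coord_pos:
  assumes n: "n \<ge> 2" and \<epsilon>: "\<epsilon> > 0"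
  shows "measure (uniform_simplex n) {x \<in> space (vec_borel n). x 1 < \<epsilon>} > 0"
proof -
  let ?A = "{x \<in> space (vec_borel n). x 1 < \<epsilon>}"
  let ?B = "{y \<in> space L. y 1 < \<epsilon>}"
  have T: "T \<in> measurable (uniform_measure L S) (vec_borel n)"
    using simplex_map_measurable n by simp
  have A: "?A \<in> sets (vec_borel n)" by measurable (use n in auto)
  have B: "?B \<in> sets L" by measurable (use n in auto)
  \<comment> \<open>\<open>T\<close> alters only coordinate \<open>n\<close>, which differs from
    coordinate 1 because \<open>n \<ge> 2\<close>.\<close>
  have "T -` ?A \<inter> space L = ?B"
    using measurable_space[OF simplex_map_measurable] n by (auto simp: T_def)
  then have "emeasure (uniform_simplex n) ?A = emeasure (uniform_measure L S) ?B"
    using A T by (simp add: uniform_simplex_eq emeasure_distr)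
  also have "\<dots> = emeasure L (S \<inter> ?B) / emeasure L S"
    using B by (intro emeasure_uniform_measure) auto
  finally have eq: "emeasure (uniform_simplex n) ?A = emeasure L (S \<inter> ?B) / emeasure L S" .
  have pos: "emeasure L (S \<inter> ?B) > 0" using n \<epsilon> by (rule emeasure_simplex_small_coord_pos)
  have le: "emeasure L (S \<inter> ?B) \<le> emeasure L S" by (intro emeasure_mono) auto
  \<comment> \<open>Both extremes must be excluded, since \<open>measure\<close> would turn an
    infinite quotient into 0.\<close>
  have "emeasure L (S \<inter> ?B) / emeasure L S \<noteq> 0"
    using pos emeasure_simplex_finite by auto
  moreover have "emeasure L (S \<inter> ?B) / emeasure L S \<noteq> \<infinity>"
    using pos le emeasure_simplex_finite by (auto simp: ennreal_divide_eq_top_iff)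
  ultimately show ?thesis
    unfolding measure_def eq by (simp add: enn2real_positive_iff less_top zero_less_iff_neq_zero)
qed

text \<open>On the solid simplex all coordinates are nonnegative, and a vanishing one confines the
  point to one of finitely many hyperplanes, each null as a graph.\<close>

lemma uniform_simplex_AE_pos:
  assumes n: "n \<ge> 2"
  shows "AE x in uniform_simplex n. \<forall>i\<in>{1..n}. x i > 0"
proof -
  have neq0: "AE y in L. y i \<noteq> 0" if "i \<in> {1..<n}" for i
    unfolding L_def using that by (intro AE_PiM_lborel_coord_neq) auto
  \<comment> \<open>The face where the last coordinate vanishes is written as a graph over the
    coordinates other than 1, the form required by the null-graph lemma.\<close>
  have "AE y in L. y 1 \<noteq> 1 - (\<Sum>i\<in>{1..<n} - {1}. y i)"
    unfolding L_def
  proof (rule AE_PiM_lborel_coord_neq)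
    show "(\<lambda>y. 1 - (\<Sum>i\<in>{1..<n} - {1}. y i)) \<in> borel_measurable (PiM {1..<n} (\<lambda>_. lborel))"
      unfolding L_def[symmetric] by (intro borel_measurable_diff borel_measurable_sum) auto
  qed (use n in auto)
  moreover have "(\<Sum>i\<in>{1..<n}. y i) = y 1 + (\<Sum>i\<in>{1..<n} - {1}. y i)" for y :: "nat \<Rightarrow> real"
    using n by (intro sum.remove) auto
  ultimately have "AE y in L. (\<Sum>i\<in>{1..<n}. y i) \<noteq> 1" by auto
  moreover have "AE y in L. \<forall>i\<in>{1..<n}. y i \<noteq> 0"
    using neq0 by (intro AE_finite_allI) auto
  ultimately have "AE y in L. y \<in> S \<longrightarrow> (\<forall>i\<in>{1..n}. T y i > 0)"
    by eventually_elim (force simp: S_def T_def)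
  then have "AE y in uniform_measure L S. \<forall>i\<in>{1..n}. T y i > 0"
    by (intro AE_uniform_measureI) auto
  then show ?thesis
    unfolding uniform_simplex_eq using simplex_map_measurable n
    by (subst AE_distr_iff) auto
qed

end


section \<open>Almost sure infinite dimension\<close>

text \<open>Along the words \<open>1...1\<close> the vectors are independent, and each has its first
  coordinate below \<open>\<epsilon>\<close> with the same probability \<open>p > 0\<close>. Failure
  at \<open>K + 1\<close> given levels has probability \<open>(1 - p) ^ (K + 1)\<close>, which tends
  to 0.\<close>

lemma (in prob_space) AE_small_coord:
  fixes X :: "nat list \<Rightarrow> 'a \<Rightarrow> nat \<Rightarrow> real"
  assumes n: "n \<ge> 2" and \<epsilon>: "\<epsilon> > 0"
    and indep: "indep_vars (\<lambda>_. vec_borel n) X (words n)"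
    and unif: "\<And>w. w \<in> words n \<Longrightarrow> distr M (vec_borel n) (X w) = uniform_simplex n"
  shows "AE a in M. \<exists>k>d. X (replicate k 1) a 1 < \<epsilon>"
proof -
  let ?V = "vec_borel n"
  define w where "w k = replicate k (1 :: nat)" for k
  define A where "A = {x \<in> space ?V. x 1 < \<epsilon>}"
  define B where "B k = X (w k) -` (space ?V - A) \<inter> space M" for k
  define p where "p = measure (uniform_simplex n) A"
  have w: "w k \<in> words n" for k using n by (auto simp: w_def)
  have A: "A \<in> sets ?V" unfolding A_def by measurable (use n in auto)
  have X: "X (w k) \<in> measurable M ?V" for k
    using indep w by (auto simp: indep_vars_def2)
  have p: "p > 0" using uniform_simplex_small_coord_pos[OF n \<epsilon>] by (simp add: p_def A_def)
  have B: "B k \<in> events" for k unfolding B_def using A X by (intro measurable_sets) auto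
  have prob_B: "prob (B k) = 1 - p" for k
  proof -
    have "prob (X (w k) -` A \<inter> space M) = p"
      using measure_distr[OF X A] unif[OF w] by (simp add: p_def)
    moreover have "B k = space M - (X (w k) -` A \<inter> space M)"
      using measurable_space[OF X] by (auto simp: B_def)
    ultimately show ?thesis
      using prob_compl[OF measurable_sets[OF X A]] by simp
  qed
  \<comment> \<open>\<open>Suc K\<close> keeps the index set nonempty, as the product formula for
    independent variables requires.\<close>
  have prob_Inter: "prob (\<Inter>k\<in>{d<..d + Suc K}. B k) = (1 - p) ^ Suc K" for K
  proof -
    \<comment> \<open>The words have different lengths, so the product over words is a product over
      levels with no factor lost.\<close>
    have inj: "inj_on w J" for J by (auto simp: w_def inj_on_def)
    have "prob (\<Inter>v\<in>w ` {d<..d + Suc K}. X v -` (space ?V - A) \<inter> space M)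
        = (\<Prod>v\<in>w ` {d<..d + Suc K}. prob (X v -` (space ?V - A) \<inter> space M))"
      using indep A w by (intro indep_varsD) auto
    then have "prob (\<Inter>k\<in>{d<..d + Suc K}. B k) = (\<Prod>k\<in>{d<..d + Suc K}. prob (B k))"
      by (simp only: prod.reindex[OF inj] image_image B_def o_def)
    then show ?thesis by (simp add: prob_B)
  qed
  define N where "N = (\<Inter>k\<in>{d<..}. B k)"
  have N: "N \<in> events" unfolding N_def using B by (intro sets.countable_INT') auto
  have "prob N \<le> (1 - p) ^ Suc K" for K
    unfolding prob_Inter[symmetric] N_def using B
    by (intro finite_measure_mono sets.finite_INT) auto
  moreover have "(\<lambda>K. (1 - p) ^ Suc K) \<longlonglongrightarrow> 0"
    using p prob_B[of 0] measure_nonneg[of M "B 0"]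
    by (intro LIMSEQ_Suc LIMSEQ_realpow_zero) auto
  ultimately have "prob N \<le> 0" by (intro LIMSEQ_le_const) auto
  then have "N \<in> null_sets M"
    using N by (simp add: null_sets_def emeasure_eq_measure measure_le_0_iff)
  then show ?thesis
  proof (rule AE_I')
    show "{a \<in> space M. \<not> (\<exists>k>d. X (replicate k 1) a 1 < \<epsilon>)} \<subseteq> N"
      using measurable_space[OF X] by (force simp: N_def B_def A_def w_def)
  qed
qed

theorem corollary4p4:
  fixes M :: "'a measure"
    and Q :: "nat list \<Rightarrow> (real ^ 'd) set"
    and X :: "nat list \<Rightarrow> 'a \<Rightarrow> nat \<Rightarrow> real"
    and \<mu> :: "'a \<Rightarrow> (real ^ 'd) measure"
    and P :: "(real ^ 'd) measure measure"
    and n :: nat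
  assumes n: "n = 2 ^ CARD('d)"
    and M: "prob_space M"
    and Q: "dyadic_indexing Q"
    and indep: "prob_space.indep_vars M (\<lambda>_. vec_borel n) X (words n)"
    and unif: "\<And>w. w \<in> words n \<Longrightarrow> distr M (vec_borel n) (X w) = uniform_simplex n"
    and random_measure: "\<mu> \<in> measurable M weak_star_borel"
    and cascade: "AE a in M. \<forall>w \<in> words n.
      measure (\<mu> a) (Q w) = (\<Prod>j<length w. X (take j w) a (w ! j))"
    and law: "P = distr M weak_star_borel \<mu>"
  shows "AE \<nu> in P. upper_assouad_dim \<nu> = \<infinity>"
proof -
  interpret prob_space M by fact
  have n2: "n \<ge> 2"
    using n power_increasing[of 1 "CARD('d)" "2 :: nat"] by (simp add: Suc_leI)
  define w where "w k = replicate k (1 :: nat)" for k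
  have w: "w k \<in> words n" "w k @ [1] \<in> words n" for k using n2 by (auto simp: w_def)
  \<comment> \<open>The inner cubes are chosen once, independently of the measure, so that the event
    below is built from countably many fixed cubes.\<close>
  have "\<exists>v. \<forall>k. v k \<in> words n \<and> (\<forall>x \<in> Q (v k). ball x (1 / 2 ^ (k + 3)) \<subseteq> Q (w k @ [1]))"
  proof (rule choice, rule allI)
    fix k
    have "w k @ [1] \<in> words (2 ^ CARD('d))" using w(2) n by simp
    then obtain u where u: "u \<in> words n"
      "\<And>x. x \<in> Q u \<Longrightarrow> ball x (1 / 2 ^ (length (w k @ [1]) + 2)) \<subseteq> Q (w k @ [1])"
      using dyadic_indexing_inner_cube[OF Q] n by metis
    have "length (w k @ [1]) + 2 = k + 3" by (simp add: w_def)
    then show "\<exists>v. v \<in> words n \<and> (\<forall>x \<in> Q v. ball x (1 / 2 ^ (k + 3)) \<subseteq> Q (w k @ [1]))"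
      using u by metis
  qed
  then obtain v where v: "\<And>k. v k \<in> words n"
    "\<And>k x. x \<in> Q (v k) \<Longrightarrow> ball x (1 / 2 ^ (k + 3)) \<subseteq> Q (w k @ [1])"
    by blast
  \<comment> \<open>This is the smaller event: a countable combination of inequalities between
    masses of cubes, hence measurable, and sufficient for infinite dimension.\<close>
  define good where "good \<nu> \<longleftrightarrow> (\<forall>m :: nat. \<exists>k. k > CARD('d) \<and> measure \<nu> (Q (v k)) > 0 \<and>
    m * measure \<nu> (Q (w k @ [1])) < measure \<nu> (Q (w k)))" for \<nu>
  have dim: "upper_assouad_dim \<nu> = \<infinity>" if "\<nu> \<in> prob_measures" "good \<nu>" for \<nu>
  \<comment> \<open>Since \<open>w k\<close> has length \<open>k\<close>, the level and thus the
    inner cube can be recovered from the word.\<close>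
  proof (rule upper_assouad_dim_infinite_dyadic[OF Q that(1),
        where W = "range w" and core = "\<lambda>u. v (length u)"])
    have len: "length (w k) = k" for k by (simp add: w_def)
    show "\<exists>u \<in> range w. length u > CARD('d) \<and> measure \<nu> (Q (v (length u))) > 0 \<and>
      m * measure \<nu> (Q (u @ [1])) < measure \<nu> (Q u)" for m :: nat
      using that(2) len unfolding good_def by (metis rangeI)
    fix u assume "u \<in> range w"
    then obtain k where u: "u = w k" by blast
    show "u @ [1] \<in> words (2 ^ CARD('d)) \<and> v (length u) \<in> words (2 ^ CARD('d))"
      using v(1) w(2) u len n by simp
    show "ball x (1 / 2 ^ (length u + 3)) \<subseteq> Q (u @ [1])" if "x \<in> Q (v (length u))" for x
      using v(2) that unfolding u len .
  qed
  have meas: "(\<lambda>\<nu>. measure \<nu> (Q u)) \<in> borel_measurable weak_star_borel" if "u \<in> words n" for u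
    using measurable_weak_star_measure[OF dyadic_indexing_borel(1)[OF Q]]
      dyadic_indexing_borel(2)[OF Q] that n by (metis inf.absorb1)
  note [measurable] = meas[OF v(1)] meas[OF w(1)] meas[OF w(2)]
  have good: "{\<nu> \<in> space weak_star_borel. good \<nu>} \<in> sets weak_star_borel"
    unfolding good_def by measurable
  have "AE a in M. \<forall>i\<in>{1..n}. X u a i > 0" if "u \<in> words n" for u
  proof -
    have "X u \<in> measurable M (vec_borel n)" using indep that by (auto simp: indep_vars_def2)
    moreover have "AE x in distr M (vec_borel n) (X u). \<forall>i\<in>{1..n}. x i > 0"
      unfolding unif[OF that] using n2 by (rule uniform_simplex_AE_pos)
    ultimately show ?thesis by (rule AE_distrD)
  qed
  \<comment> \<open>There are only countably many words, so the exceptional null sets can be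
    united.\<close>
  then have "AE a in M. \<forall>u \<in> words n. \<forall>i\<in>{1..n}. X u a i > 0"
    by (subst AE_ball_countable) (rule countableI_type, rule ballI)
  \<comment> \<open>\<open>Suc m\<close> avoids division by zero at \<open>m = 0\<close>, where the
    bound would be 0.\<close>
  moreover have "AE a in M. \<forall>m :: nat. \<exists>k>CARD('d). X (w k) a 1 < 1 / Suc m"
    unfolding w_def AE_all_countable
    by (intro allI AE_small_coord[OF n2 _ indep unif]) simp_all
  ultimately have "AE a in M. good (\<mu> a)"
    using cascade
  proof eventually_elim
    case (elim a)
    have pos: "measure (\<mu> a) (Q u) > 0" if "u \<in> words n" for u
    proof -
      have "X (take j u) a (u ! j) > 0" if "j < length u" for j
      proof -
        have "set u \<subseteq> {1..n}" using \<open>u \<in> words n\<close> by (simp only: lists_eq_set mem_Collect_eq)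
        then have "take j u \<in> words n" "u ! j \<in> {1..n}"
          using set_take_subset[of j u] nth_mem[OF that] unfolding lists_eq_set by blast+
        then show ?thesis using elim(1) by blast
      qed
      then have "(\<Prod>j<length u. X (take j u) a (u ! j)) > 0" by (intro prod_pos) auto
      then show ?thesis using elim(3) that by simp
    qed
    show "good (\<mu> a)"
      unfolding good_def
    proof
      fix m :: nat
      obtain k where k: "k > CARD('d)" "X (w k) a 1 < 1 / Suc m" using elim(2) by blast
      \<comment> \<open>Appending one letter adds exactly the last factor \<open>X (w k) a 1\<close>
        to the product formula; this is the conditional mass that was made small.\<close>
      have "measure (\<mu> a) (Q (w k @ [1])) = measure (\<mu> a) (Q (w k)) * X (w k) a 1"
        using elim(3) w by (simp add: nth_append)
      moreover have "m * X (w k) a 1 < 1"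
      proof -
        have "X (w k) a 1 > 0" using elim(1) w(1) n2 by simp
        then show ?thesis using k(2) by (simp add: field_simps)
      qed
      ultimately have "m * measure (\<mu> a) (Q (w k @ [1])) < measure (\<mu> a) (Q (w k))"
        using pos[OF w(1), of k] by (simp add: mult.left_commute)
      then show "\<exists>k. k > CARD('d) \<and> measure (\<mu> a) (Q (v k)) > 0 \<and>
          m * measure (\<mu> a) (Q (w k @ [1])) < measure (\<mu> a) (Q (w k))"
        using k(1) pos[OF v(1)] by blast
    qed
  qed
  \<comment> \<open>Measurability of the event \<open>good\<close> allows the almost sure statement
    to pass from \<open>M\<close> to the law of \<open>\<mu>\<close>.\<close>
  then have "AE \<nu> in P. good \<nu>"
    unfolding law using good by (subst AE_distr_iff[OF random_measure]) auto
  moreover have "AE \<nu> in P. \<nu> \<in> prob_measures"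
    by (rule AE_I2) (simp add: law space_weak_star_borel)
  ultimately show ?thesis
    by eventually_elim (rule dim)
qed

end
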